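(* Let $a\in L_\pi(\mathbb{R},\mathbb{R})$ satisfy $0\prec a$, and suppose that there exist $\alpha\in(0,\frac{\pi}{2})$ and $x_0\in\left(\frac{\pi}{2}(1-\cos\alpha),\frac{\pi}{2}(1+\cos\alpha)\right)$ such that $$\max\left\{x_0^2\,\|a\|_{L^\infty(0,x_0)},\ (\pi-x_0)^2\,\|a\|_{L^\infty(x_0,\pi)}\right\}\le\alpha^2.$$ Then the Hill's equation $u''(x)+a(x)u(x)=0$ is stable.
   Context: $L_\pi(\mathbb{R},\mathbb{R})$ is the set of $\pi$-periodic functions $a:\mathbb{R}\to\mathbb{R}$ with $a|_{[0,\pi]}\in L^1(0,\pi)$. $0\prec a$ means $a(x)\ge 0$ for a.e. $x\in[0,\pi]$ and $a(x)>0$ on a set of positive measure. The equation is stable (in the sense of Lyapunov) if all its solutions are bounded on $\mathbb{R}$ together with their derivatives. *)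

theory Defs
  imports "HOL-Analysis.Analysis" "HOL-Probability.Essential_Supremum"
begin

definition L_pi :: "(real \<Rightarrow> real) set" where
  "L_pi = {a. (\<forall>x. a (x + pi) = a x) \<and> a absolutely_integrable_on {0..pi}}"

definition succ_zero :: "(real \<Rightarrow> real) \<Rightarrow> bool" where
  "succ_zero a \<longleftrightarrow>
     (AE x in lebesgue_on {0..pi}. a x \<ge> 0) \<and>
     emeasure lebesgue {x \<in> {0..pi}. a x > 0} > 0"

(* Extended-real valued: a function in L^1 may well be essentially unbounded. *)
definition Linfty_norm :: "real \<Rightarrow> real \<Rightarrow> (real \<Rightarrow> real) \<Rightarrow> ereal" where
  "Linfty_norm s t a = esssup (lebesgue_on {s<..<t}) (\<lambda>x. ereal \<bar>a x\<bar>)"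

(* Absolute continuity of a function on a compact interval; the constant
   absolutely_continuous of HOL-Analysis is the unrelated notion for measures. *)
definition abs_continuous_on :: "real \<Rightarrow> real \<Rightarrow> (real \<Rightarrow> real) \<Rightarrow> bool" where
  "abs_continuous_on s t f \<longleftrightarrow>
     (\<forall>\<epsilon>>0. \<exists>\<delta>>0. \<forall>(n::nat) l r.
        (\<forall>i<n. s \<le> l i \<and> l i \<le> r i \<and> r i \<le> t) \<longrightarrow>
        disjoint_family_on (\<lambda>i. {l i<..<r i}) {..<n} \<longrightarrow>
        (\<Sum>i<n. r i - l i) < \<delta> \<longrightarrow>
        (\<Sum>i<n. \<bar>f (r i) - f (l i)\<bar>) < \<epsilon>)"

(* Since a is only locally integrable, solutions of u'' + a u = 0 are understood in
   the sense of Caratheodory: u is C^1, u' is locally absolutely continuous, and the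
   equation holds almost everywhere. *)
definition hill_solution :: "(real \<Rightarrow> real) \<Rightarrow> (real \<Rightarrow> real) \<Rightarrow> bool" where
  "hill_solution a u \<longleftrightarrow>
     (\<forall>x. u differentiable (at x)) \<and>
     (\<forall>s t. abs_continuous_on s t (deriv u)) \<and>
     (AE x in lebesgue.
        deriv u differentiable (at x) \<and> deriv (deriv u) x + a x * u x = 0)"

definition hill_stable :: "(real \<Rightarrow> real) \<Rightarrow> bool" where
  "hill_stable a \<longleftrightarrow>
     (\<forall>u. hill_solution a u \<longrightarrow> bounded (range u) \<and> bounded (range (deriv u)))"

end

theory Submission
  imports Defs
begin

text \<open>
  The hypothesis makes \<open>a\<close> essentially bounded by the \<open>\<pi>\<close>-periodic step function with the values
  \<open>\<omega>1\<^sup>2 = (\<alpha> / x0)\<^sup>2\<close> on \<open>(0, x0)\<close> and \<open>\<omega>2\<^sup>2 = (\<alpha> / (\<pi> - x0))\<^sup>2\<close> on \<open>(x0, \<pi>)\<close>, so that the phase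
  of the step equation advances by exactly \<open>\<alpha>\<close> on each of the two steps.  The trace of its monodromy
  matrix is \<open>2 cos\<^sup>2 \<alpha> - (\<omega>1 / \<omega>2 + \<omega>2 / \<omega>1) sin\<^sup>2 \<alpha>\<close>, and the condition on \<open>x0\<close> says
  precisely that this is greater than \<open>-2\<close>.  The proof transfers this to \<open>a\<close> by comparison.

  \<^item> Let \<open>T\<close> be the translation by \<open>\<pi>\<close>, acting on solutions.  If no nonzero solution satisfies
  \<open>T u = \<rho> u\<close> with real \<open>\<rho>\<close>, then \<open>u\<close> and \<open>T u\<close> are independent for every \<open>u \<noteq> 0\<close>, and constancy of
  the Wronskian gives \<open>T (T u) = A (T u) - u\<close>.  Real roots of \<open>\<rho>\<^sup>2 - A \<rho> + 1\<close> would produce a real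
  multiplier, so \<open>\<bar>A\<bar> < 2\<close>; then \<open>(T u)\<^sup>2 - A u (T u) + u\<^sup>2\<close> is a positive definite form that is
  \<open>\<pi>\<close>-periodic in \<open>x\<close>, which bounds \<open>u\<close>, and likewise \<open>u'\<close> (\<open>stable_if_no_real_multiplier\<close>).
  This argument stays inside the set of given solutions and never constructs one.

  \<^item> A multiplier solution without zeros has a periodic logarithmic derivative \<open>w\<close> with
  \<open>w' = - a - w\<^sup>2 \<le> 0\<close>, hence constant \<open>w\<close> and \<open>a \<le> 0\<close> almost everywhere, contradicting \<open>0 \<prec> a\<close>
  (\<open>multiplier_solution_has_zero\<close>).

  \<^item> A multiplier solution with a zero \<open>c\<close> also vanishes at \<open>c + \<pi>\<close>.  The interval \<open>[c, c + \<pi>]\<close> meets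
  three steps, and gluing suitable cosines on them gives a positive supersolution of the step
  equation, with a logarithmic derivative that is continuous across the breakpoints.  Picone's identity then
  excludes a nonzero solution that vanishes at both ends (\<open>hill_disconjugate\<close>).

  As solutions are meant in the sense of Caratheodory, each of these steps rests on one fact about
  absolutely continuous functions: a derivative that is nonpositive almost everywhere forces the
  function to be nonincreasing (\<open>abs_continuous_on_antimono\<close>).
\<close>

section \<open>Absolutely continuous functions\<close>

lemma abs_continuous_on_subinterval:
  assumes "abs_continuous_on s t f" "s \<le> s'" "t' \<le> t"
  shows "abs_continuous_on s' t' f"
  unfolding abs_continuous_on_def
proof (intro allI impI)
  fix e :: real assume "e > 0"
  then obtain d where "d > 0" and d: "\<And>(n::nat) l r. (\<forall>i<n. s \<le> l i \<and> l i \<le> r i \<and> r i \<le> t) \<Longrightarrow>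
        disjoint_family_on (\<lambda>i. {l i<..<r i}) {..<n} \<Longrightarrow>
        (\<Sum>i<n. r i - l i) < d \<Longrightarrow> (\<Sum>i<n. \<bar>f (r i) - f (l i)\<bar>) < e"
    using assms(1) unfolding abs_continuous_on_def by blast
  show "\<exists>d>0. \<forall>(n::nat) l r. (\<forall>i<n. s' \<le> l i \<and> l i \<le> r i \<and> r i \<le> t') \<longrightarrow>
        disjoint_family_on (\<lambda>i. {l i<..<r i}) {..<n} \<longrightarrow>
        (\<Sum>i<n. r i - l i) < d \<longrightarrow> (\<Sum>i<n. \<bar>f (r i) - f (l i)\<bar>) < e"
    using \<open>d > 0\<close> assms(2,3) by (intro exI[of _ d]) (auto intro!: d intro: order_trans)
qed

lemma abs_continuous_on_imp_continuous_on:
  assumes "abs_continuous_on s t f"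
  shows "continuous_on {s..t} f"
  unfolding continuous_on_iff
proof (intro ballI allI impI)
  fix x e :: real assume x: "x \<in> {s..t}" and "e > 0"
  then obtain d where "d > 0" and d: "\<And>(n::nat) l r. (\<forall>i<n. s \<le> l i \<and> l i \<le> r i \<and> r i \<le> t) \<Longrightarrow>
        disjoint_family_on (\<lambda>i. {l i<..<r i}) {..<n} \<Longrightarrow>
        (\<Sum>i<n. r i - l i) < d \<Longrightarrow> (\<Sum>i<n. \<bar>f (r i) - f (l i)\<bar>) < e"
    using assms unfolding abs_continuous_on_def by blast
  have "dist (f y) (f x) < e" if y: "y \<in> {s..t}" "dist y x < d" for y
    using d[of 1 "\<lambda>_. x" "\<lambda>_. y"] d[of 1 "\<lambda>_. y" "\<lambda>_. x"] x y
    by (cases "x \<le> y") (simp_all add: dist_real_def disjoint_family_on_def abs_minus_commute)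
  then show "\<exists>d>0. \<forall>y\<in>{s..t}. dist y x < d \<longrightarrow> dist (f y) (f x) < e"
    using \<open>d > 0\<close> by blast
qed

lemma abs_continuous_on_lipschitz:
  assumes "\<And>x y. s \<le> x \<Longrightarrow> x \<le> y \<Longrightarrow> y \<le> t \<Longrightarrow> \<bar>f y - f x\<bar> \<le> B * (y - x)"
  shows "abs_continuous_on s t f"
  unfolding abs_continuous_on_def
proof (intro allI impI)
  fix e :: real assume e: "e > 0"
  define C where "C = \<bar>B\<bar> + 1"
  have C: "C > 0" "B \<le> C" by (auto simp: C_def)
  have "(\<Sum>i<n. \<bar>f (r i) - f (l i)\<bar>) < e"
    if lr: "\<forall>i<n. s \<le> l i \<and> l i \<le> r i \<and> r i \<le> t" and sm: "(\<Sum>i<n. r i - l i) < e / C"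
    for n :: nat and l r :: "nat \<Rightarrow> real"
  proof -
    have "(\<Sum>i<n. \<bar>f (r i) - f (l i)\<bar>) \<le> (\<Sum>i<n. C * (r i - l i))"
    proof (rule sum_mono)
      fix i assume "i \<in> {..<n}"
      then have i: "s \<le> l i" "l i \<le> r i" "r i \<le> t" using lr by auto
      have "\<bar>f (r i) - f (l i)\<bar> \<le> B * (r i - l i)" using assms i by blast
      also have "\<dots> \<le> C * (r i - l i)" using C i by (intro mult_right_mono) auto
      finally show "\<bar>f (r i) - f (l i)\<bar> \<le> C * (r i - l i)" .
    qed
    also have "\<dots> = C * (\<Sum>i<n. r i - l i)" by (simp add: sum_distrib_left)
    also have "\<dots> < e" using sm C by (simp add: field_simps)
    finally show ?thesis .
  qed
  then show "\<exists>d>0. \<forall>(n::nat) l r. (\<forall>i<n. s \<le> l i \<and> l i \<le> r i \<and> r i \<le> t) \<longrightarrow>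
        disjoint_family_on (\<lambda>i. {l i<..<r i}) {..<n} \<longrightarrow>
        (\<Sum>i<n. r i - l i) < d \<longrightarrow> (\<Sum>i<n. \<bar>f (r i) - f (l i)\<bar>) < e"
    using e C by (intro exI[of _ "e / C"]) auto
qed

lemma abs_continuous_on_C1:
  assumes d: "\<And>x. x \<in> {s..t} \<Longrightarrow> (f has_real_derivative f' x) (at x)"
    and c: "continuous_on {s..t} f'"
  shows "abs_continuous_on s t f"
proof -
  have "bounded (f' ` {s..t})"
    using c compact_continuous_image compact_imp_bounded by blast
  then obtain B where B: "\<And>x. x \<in> {s..t} \<Longrightarrow> \<bar>f' x\<bar> \<le> B"
    unfolding bounded_iff by (metis imageI real_norm_def)
  show ?thesis
  proof (rule abs_continuous_on_lipschitz[of _ _ _ B])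
    fix x y assume xy: "s \<le> x" "x \<le> y" "y \<le> t"
    have "norm (f y - f x) \<le> B * norm (y - x)"
      using xy B d[THEN has_field_derivative_at_within]
      by (intro field_differentiable_bound[of "{s..t}" f f']) auto
    then show "\<bar>f y - f x\<bar> \<le> B * (y - x)" using xy by simp
  qed
qed

text \<open>The increments of sums, differences, constant multiples and products (of bounded factors) are
  all controlled in this way, so one epsilon argument serves for all of them.\<close>

lemma abs_continuous_on_dominated:
  assumes f: "abs_continuous_on s t f" and g: "abs_continuous_on s t g"
    and h: "\<And>x y. x \<in> {s..t} \<Longrightarrow> y \<in> {s..t} \<Longrightarrow> \<bar>h y - h x\<bar> \<le> B * (\<bar>f y - f x\<bar> + \<bar>g y - g x\<bar>)"
  shows "abs_continuous_on s t h"
  unfolding abs_continuous_on_def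
proof (intro allI impI)
  fix e :: real assume e: "e > 0"
  define C where "C = \<bar>B\<bar> + 1"
  have C: "C > 0" "B \<le> C" by (auto simp: C_def)
  have e': "e / (2 * C) > 0" using e C by simp
  obtain d1 where "d1 > 0" and d1: "\<And>(n::nat) l r. (\<forall>i<n. s \<le> l i \<and> l i \<le> r i \<and> r i \<le> t) \<Longrightarrow>
        disjoint_family_on (\<lambda>i. {l i<..<r i}) {..<n} \<Longrightarrow>
        (\<Sum>i<n. r i - l i) < d1 \<Longrightarrow> (\<Sum>i<n. \<bar>f (r i) - f (l i)\<bar>) < e / (2 * C)"
    using f e' unfolding abs_continuous_on_def by blast
  obtain d2 where "d2 > 0" and d2: "\<And>(n::nat) l r. (\<forall>i<n. s \<le> l i \<and> l i \<le> r i \<and> r i \<le> t) \<Longrightarrow>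
        disjoint_family_on (\<lambda>i. {l i<..<r i}) {..<n} \<Longrightarrow>
        (\<Sum>i<n. r i - l i) < d2 \<Longrightarrow> (\<Sum>i<n. \<bar>g (r i) - g (l i)\<bar>) < e / (2 * C)"
    using g e' unfolding abs_continuous_on_def by blast
  have "(\<Sum>i<n. \<bar>h (r i) - h (l i)\<bar>) < e"
    if lr: "\<forall>i<n. s \<le> l i \<and> l i \<le> r i \<and> r i \<le> t"
      and dj: "disjoint_family_on (\<lambda>i. {l i<..<r i}) {..<n}"
      and sm: "(\<Sum>i<n. r i - l i) < min d1 d2"
    for n :: nat and l r :: "nat \<Rightarrow> real"
  proof -
    have "(\<Sum>i<n. \<bar>h (r i) - h (l i)\<bar>)
        \<le> (\<Sum>i<n. C * (\<bar>f (r i) - f (l i)\<bar> + \<bar>g (r i) - g (l i)\<bar>))"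
    proof (rule sum_mono)
      fix i assume "i \<in> {..<n}"
      then have i: "l i \<in> {s..t}" "r i \<in> {s..t}" using lr by force+
      have "\<bar>h (r i) - h (l i)\<bar> \<le> B * (\<bar>f (r i) - f (l i)\<bar> + \<bar>g (r i) - g (l i)\<bar>)"
        using h i by blast
      also have "\<dots> \<le> C * (\<bar>f (r i) - f (l i)\<bar> + \<bar>g (r i) - g (l i)\<bar>)"
        using C by (intro mult_right_mono) auto
      finally show "\<bar>h (r i) - h (l i)\<bar> \<le> C * (\<bar>f (r i) - f (l i)\<bar> + \<bar>g (r i) - g (l i)\<bar>)" .
    qed
    also have "\<dots> = C * ((\<Sum>i<n. \<bar>f (r i) - f (l i)\<bar>) + (\<Sum>i<n. \<bar>g (r i) - g (l i)\<bar>))"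
      by (simp flip: sum_distrib_left sum.distrib)
    also have "\<dots> < C * (e / (2 * C) + e / (2 * C))"
      using d1[OF lr dj] d2[OF lr dj] sm C by (intro mult_strict_left_mono add_strict_mono) auto
    also have "\<dots> = e" using C by (simp add: field_simps)
    finally show ?thesis .
  qed
  then show "\<exists>d>0. \<forall>(n::nat) l r. (\<forall>i<n. s \<le> l i \<and> l i \<le> r i \<and> r i \<le> t) \<longrightarrow>
        disjoint_family_on (\<lambda>i. {l i<..<r i}) {..<n} \<longrightarrow>
        (\<Sum>i<n. r i - l i) < d \<longrightarrow> (\<Sum>i<n. \<bar>h (r i) - h (l i)\<bar>) < e"
    using \<open>d1 > 0\<close> \<open>d2 > 0\<close> by (intro exI[of _ "min d1 d2"]) auto
qed

lemma abs_continuous_on_add: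
  assumes "abs_continuous_on s t f" "abs_continuous_on s t g"
  shows "abs_continuous_on s t (\<lambda>x. f x + g x)"
  by (rule abs_continuous_on_dominated[OF assms, of _ 1]) auto

lemma abs_continuous_on_diff:
  assumes "abs_continuous_on s t f" "abs_continuous_on s t g"
  shows "abs_continuous_on s t (\<lambda>x. f x - g x)"
  by (rule abs_continuous_on_dominated[OF assms, of _ 1]) auto

lemma abs_continuous_on_mult:
  assumes f: "abs_continuous_on s t f" and g: "abs_continuous_on s t g"
  shows "abs_continuous_on s t (\<lambda>x. f x * g x)"
proof -
  have "bounded (f ` {s..t})" "bounded (g ` {s..t})"
    using assms abs_continuous_on_imp_continuous_on compact_continuous_image compact_imp_bounded
    by blast+
  then obtain B1 B2 where B1: "\<And>x. x \<in> {s..t} \<Longrightarrow> \<bar>f x\<bar> \<le> B1"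
    and B2: "\<And>x. x \<in> {s..t} \<Longrightarrow> \<bar>g x\<bar> \<le> B2"
    unfolding bounded_iff by (metis imageI real_norm_def)
  show ?thesis
  proof (rule abs_continuous_on_dominated[OF f g, of _ "max B1 B2"])
    fix x y assume xy: "x \<in> {s..t}" "y \<in> {s..t}"
    have "f y * g y - f x * g x = g y * (f y - f x) + f x * (g y - g x)"
      by (simp add: algebra_simps)
    then have "\<bar>f y * g y - f x * g x\<bar> \<le> \<bar>g y\<bar> * \<bar>f y - f x\<bar> + \<bar>f x\<bar> * \<bar>g y - g x\<bar>"
      by (metis abs_mult abs_triangle_ineq)
    also have "\<dots> \<le> max B1 B2 * \<bar>f y - f x\<bar> + max B1 B2 * \<bar>g y - g x\<bar>"
      using B1[OF xy(1)] B2[OF xy(2)] by (intro add_mono mult_right_mono) auto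
    finally show "\<bar>f y * g y - f x * g x\<bar> \<le> max B1 B2 * (\<bar>f y - f x\<bar> + \<bar>g y - g x\<bar>)"
      by (simp add: algebra_simps)
  qed
qed

lemma abs_continuous_on_cmult:
  assumes "abs_continuous_on s t f"
  shows "abs_continuous_on s t (\<lambda>x. c * f x)"
  by (rule abs_continuous_on_dominated[OF assms assms, of _ "\<bar>c\<bar>"])
     (auto simp: abs_mult mult_left_mono simp flip: right_diff_distrib)

lemma abs_continuous_on_shift:
  assumes "abs_continuous_on (s + p) (t + p) f"
  shows "abs_continuous_on s t (\<lambda>x. f (x + p))"
  unfolding abs_continuous_on_def
proof (intro allI impI)
  fix e :: real assume "e > 0"
  then obtain d where "d > 0" and d: "\<And>(n::nat) l r. (\<forall>i<n. s + p \<le> l i \<and> l i \<le> r i \<and> r i \<le> t + p) \<Longrightarrow>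
        disjoint_family_on (\<lambda>i. {l i<..<r i}) {..<n} \<Longrightarrow>
        (\<Sum>i<n. r i - l i) < d \<Longrightarrow> (\<Sum>i<n. \<bar>f (r i) - f (l i)\<bar>) < e"
    using assms unfolding abs_continuous_on_def by blast
  have "(\<Sum>i<n. \<bar>f (r i + p) - f (l i + p)\<bar>) < e"
    if lr: "\<forall>i<n. s \<le> l i \<and> l i \<le> r i \<and> r i \<le> t"
      and dj: "disjoint_family_on (\<lambda>i. {l i<..<r i}) {..<n}"
      and sm: "(\<Sum>i<n. r i - l i) < d"
    for n :: nat and l r :: "nat \<Rightarrow> real"
  proof (rule d)
    have "{l i + p<..<r i + p} \<inter> {l j + p<..<r j + p} = {}"
      if "{l i<..<r i} \<inter> {l j<..<r j} = {}" for i j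
    proof -
      have "x - p \<notin> {l i<..<r i} \<inter> {l j<..<r j}" for x using that by blast
      moreover have "x - p \<in> {l k<..<r k} \<longleftrightarrow> x \<in> {l k + p<..<r k + p}" for x k by auto
      ultimately show ?thesis by blast
    qed
    then show "disjoint_family_on (\<lambda>i. {l i + p<..<r i + p}) {..<n}"
      using dj unfolding disjoint_family_on_def by blast
  qed (use lr sm in auto)
  then show "\<exists>d>0. \<forall>(n::nat) l r. (\<forall>i<n. s \<le> l i \<and> l i \<le> r i \<and> r i \<le> t) \<longrightarrow>
        disjoint_family_on (\<lambda>i. {l i<..<r i}) {..<n} \<longrightarrow>
        (\<Sum>i<n. r i - l i) < d \<longrightarrow> (\<Sum>i<n. \<bar>f (r i + p) - f (l i + p)\<bar>) < e"
    using \<open>d > 0\<close> by blast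
qed

lemma AE_lebesgue_iff_negligible:
  fixes P :: "'a::euclidean_space \<Rightarrow> bool"
  shows "(AE x in lebesgue. P x) \<longleftrightarrow> negligible {x. \<not> P x}"
proof
  assume "AE x in lebesgue. P x"
  then obtain N where "{x. \<not> P x} \<subseteq> N" "N \<in> null_sets lebesgue"
    by (auto elim!: AE_E simp: null_sets_def)
  then show "negligible {x. \<not> P x}"
    by (metis negligible_iff_null_sets negligible_subset)
next
  assume "negligible {x. \<not> P x}"
  then show "AE x in lebesgue. P x"
    by (intro AE_I'[of "{x. \<not> P x}"]) (auto simp: negligible_iff_null_sets)
qed

text \<open>Take a tagged division fine for a suitable gauge.  On subintervals tagged at a point of nonpositive
  derivative, the increment of \<open>f\<close> is at most \<open>e\<close> times the length.  The subintervals tagged in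
  the exceptional null set lie in an open set of small measure, so absolute continuity makes the
  sum of their increments small.\<close>

lemma abs_continuous_on_antimono:
  assumes ac: "abs_continuous_on s t f" and st: "s \<le> t"
    and deriv: "AE x in lebesgue. s < x \<and> x < t \<longrightarrow> (\<exists>D\<le>0. (f has_real_derivative D) (at x))"
  shows "f t \<le> f s"
proof (rule field_le_epsilon)
  fix e0 :: real assume "e0 > 0"
  define e where "e = e0 / (t - s + 1)"
  have "e > 0" "e * (t - s + 1) = e0"
    using \<open>e0 > 0\<close> st by (auto simp: e_def)
  then have e: "e > 0" "e * (t - s) + e = e0" by (auto simp: distrib_left)
  obtain d where "d > 0" and d: "\<And>(n::nat) l r. (\<forall>i<n. s \<le> l i \<and> l i \<le> r i \<and> r i \<le> t) \<Longrightarrow>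
        disjoint_family_on (\<lambda>i. {l i<..<r i}) {..<n} \<Longrightarrow>
        (\<Sum>i<n. r i - l i) < d \<Longrightarrow> (\<Sum>i<n. \<bar>f (r i) - f (l i)\<bar>) < e"
    using ac e(1) unfolding abs_continuous_on_def by blast
  define N where "N = {x. \<not> (s < x \<and> x < t \<longrightarrow> (\<exists>D\<le>0. (f has_real_derivative D) (at x)))} \<union> {s, t}"
  have "N \<in> null_sets lebesgue"
    using deriv unfolding N_def negligible_iff_null_sets[symmetric] AE_lebesgue_iff_negligible
    by (intro negligible_Un) auto
  then have Ns: "N \<in> sets lebesgue" and N0: "emeasure lebesgue N = 0" by auto
  obtain U where U: "open U" "N \<subseteq> U" "U - N \<in> lmeasurable" "emeasure lebesgue (U - N) < ennreal d"
    using sets_lebesgue_outer_open[OF Ns \<open>d > 0\<close>] by metis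
  have "emeasure lebesgue U \<le> emeasure lebesgue N + emeasure lebesgue (U - N)"
    using U Ns by (metis Diff_partition emeasure_subadditive fmeasurableD)
  then have Ud: "emeasure lebesgue U < ennreal d" using U(4) N0 by simp
  have "\<exists>\<delta>>0. (x \<in> N \<longrightarrow> ball x \<delta> \<subseteq> U) \<and>
      (x \<in> {s..t} - N \<longrightarrow> (\<forall>l r. l \<le> x \<and> x \<le> r \<and> {l..r} \<subseteq> ball x \<delta> \<longrightarrow> f r - f l \<le> e * (r - l)))" for x
  proof (cases "x \<in> N")
    case True
    then show ?thesis using U(1,2) by (auto simp: open_contains_ball)
  next
    case False
    show ?thesis
    proof (cases "x \<in> {s..t}")
      case True
      with False obtain D where D: "D \<le> 0" "(f has_real_derivative D) (at x)"
        by (force simp: N_def)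
      then obtain \<delta> where \<delta>: "\<delta> > 0"
        "\<And>y. norm (y - x) < \<delta> \<Longrightarrow> norm (f y - f x - D * (y - x)) \<le> e * norm (y - x)"
        using e(1) unfolding has_field_derivative_def has_derivative_at_alt by (metis mult.commute)
      have "f r - f l \<le> e * (r - l)" if lr: "l \<le> x" "x \<le> r" "{l..r} \<subseteq> ball x \<delta>" for l r
      proof -
        have "l \<in> ball x \<delta>" "r \<in> ball x \<delta>" using lr by (meson atLeastAtMost_iff order_trans order_refl subsetD)+
        then have "\<bar>f l - f x - D * (l - x)\<bar> \<le> e * (x - l)" "\<bar>f r - f x - D * (r - x)\<bar> \<le> e * (r - x)"
          using \<delta>(2)[of l] \<delta>(2)[of r] lr by (auto simp: dist_real_def)
        then have "f r - f l \<le> e * (r - l) + D * (r - l)" by (simp add: algebra_simps)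
        also have "D * (r - l) \<le> 0" using D lr by (simp add: mult_nonpos_nonneg)
        finally show ?thesis by simp
      qed
      then show ?thesis using \<open>\<delta> > 0\<close> False by blast
    qed (use False in \<open>auto intro!: exI[of _ 1]\<close>)
  qed
  then obtain \<delta> where \<delta>: "\<And>x. \<delta> x > 0" "\<And>x. x \<in> N \<Longrightarrow> ball x (\<delta> x) \<subseteq> U"
    "\<And>x l r. x \<in> {s..t} - N \<Longrightarrow> l \<le> x \<Longrightarrow> x \<le> r \<Longrightarrow> {l..r} \<subseteq> ball x (\<delta> x) \<Longrightarrow> f r - f l \<le> e * (r - l)"
    by metis
  have "gauge (\<lambda>x. ball x (\<delta> x))" using \<delta>(1) by (simp add: gauge_def)
  then obtain p where p: "p tagged_division_of {s..t}" and fine: "(\<lambda>x. ball x (\<delta> x)) fine p"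
    using fine_division_exists_real by blast
  have piece: "s \<le> Inf K \<and> Inf K \<le> x \<and> x \<le> Sup K \<and> Sup K \<le> t \<and> K = {Inf K..Sup K} \<and> {Inf K..Sup K} \<subseteq> ball x (\<delta> x)"
    if xK: "(x, K) \<in> p" for x K
  proof -
    obtain l r where K: "K = {l..r}" using tagged_division_ofD(4)[OF p xK] by auto
    have "x \<in> K" "K \<subseteq> {s..t}" "K \<subseteq> ball x (\<delta> x)"
      using tagged_division_ofD(2,3)[OF p xK] fineD[OF fine xK] by blast+
    then show ?thesis unfolding K by (auto simp: subset_iff)
  qed
  have fin: "finite p" using p by blast
  \<comment> \<open>The subintervals tagged in the null set, enumerated as the definition of absolute continuity demands.\<close>
  define q where "q = {z \<in> p. fst z \<in> N}"
  have "finite q" using fin by (simp add: q_def)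
  then obtain h where h: "bij_betw h {..<card q} q"
    using ex_bij_betw_nat_finite by (metis atLeast0LessThan)
  define l r where "l = (\<lambda>i. Inf (snd (h i)))" and "r = (\<lambda>i. Sup (snd (h i)))"
  have hq: "h i \<in> p \<and> fst (h i) \<in> N" if "i < card q" for i
    using h that unfolding bij_betw_def q_def by auto
  have lr: "\<forall>i<card q. s \<le> l i \<and> l i \<le> r i \<and> r i \<le> t"
  proof (intro allI impI)
    fix i assume "i < card q"
    then have "(fst (h i), snd (h i)) \<in> p" using hq by simp
    from piece[OF this] show "s \<le> l i \<and> l i \<le> r i \<and> r i \<le> t" by (auto simp: l_def r_def)
  qed
  have int: "interior (snd (h i)) = {l i<..<r i}" if "i < card q" for i
  proof -
    have "(fst (h i), snd (h i)) \<in> p" using hq that by simp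
    from piece[OF this] have "snd (h i) = {l i..r i}" by (auto simp: l_def r_def)
    then show ?thesis by simp
  qed
  have dj: "disjoint_family_on (\<lambda>i. {l i<..<r i}) {..<card q}"
    unfolding disjoint_family_on_def
  proof (intro ballI impI)
    fix i j assume ij: "i \<in> {..<card q}" "j \<in> {..<card q}" "i \<noteq> j"
    then have "h i \<noteq> h j" using h by (auto simp: bij_betw_def inj_on_def)
    then have "interior (snd (h i)) \<inter> interior (snd (h j)) = {}"
      using tagged_division_ofD(5)[OF p, of "fst (h i)" "snd (h i)" "fst (h j)" "snd (h j)"] hq ij
      by (auto simp: prod_eq_iff)
    then show "{l i<..<r i} \<inter> {l j<..<r j} = {}" using int ij by simp
  qed
  have sub: "(\<Union>i<card q. {l i<..<r i}) \<subseteq> U"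
  proof (rule UN_least)
    fix i assume "i \<in> {..<card q}"
    then have "(fst (h i), snd (h i)) \<in> p" "fst (h i) \<in> N" using hq by auto
    with piece[OF this(1)] \<delta>(2)[OF this(2)] show "{l i<..<r i} \<subseteq> U"
      unfolding l_def r_def by (meson greaterThanLessThan_subseteq_atLeastAtMost_iff order.refl order_trans)
  qed
  have "ennreal (\<Sum>i<card q. r i - l i) = (\<Sum>i<card q. emeasure lebesgue {l i<..<r i})"
    using lr by (subst sum_ennreal[symmetric]) auto
  also have "\<dots> = emeasure lebesgue (\<Union>i<card q. {l i<..<r i})"
    using dj by (intro sum_emeasure) auto
  also have "\<dots> \<le> emeasure lebesgue U"
    using sub U(1) by (intro emeasure_mono) auto
  finally have "ennreal (\<Sum>i<card q. r i - l i) < ennreal d"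
    using Ud by (rule le_less_trans)
  moreover have "0 \<le> (\<Sum>i<card q. r i - l i)"
    using lr by (intro sum_nonneg) auto
  ultimately have "(\<Sum>i<card q. r i - l i) < d"
    by (simp add: ennreal_less_iff)
  from d[OF lr dj this] have "(\<Sum>i<card q. \<bar>f (r i) - f (l i)\<bar>) < e" .
  moreover have "(\<Sum>i<card q. \<bar>f (r i) - f (l i)\<bar>) = (\<Sum>z\<in>q. \<bar>f (Sup (snd z)) - f (Inf (snd z))\<bar>)"
    using sum.reindex_bij_betw[OF h, of "\<lambda>z. \<bar>f (Sup (snd z)) - f (Inf (snd z))\<bar>"]
    by (simp add: l_def r_def)
  ultimately have q: "(\<Sum>z\<in>q. f (Sup (snd z)) - f (Inf (snd z))) < e"
    using sum_mono[of q "\<lambda>z. f (Sup (snd z)) - f (Inf (snd z))" "\<lambda>z. \<bar>f (Sup (snd z)) - f (Inf (snd z))\<bar>", OF abs_ge_self]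
    by linarith
  have "(\<Sum>z\<in>p - q. f (Sup (snd z)) - f (Inf (snd z))) \<le> (\<Sum>z\<in>p - q. e * (Sup (snd z) - Inf (snd z)))"
  proof (rule sum_mono)
    fix z assume "z \<in> p - q"
    then have z: "(fst z, snd z) \<in> p" "fst z \<notin> N" by (auto simp: q_def)
    from piece[OF z(1)] have "fst z \<in> {s..t} - N" using z(2) by auto
    from \<delta>(3)[OF this] piece[OF z(1)]
    show "f (Sup (snd z)) - f (Inf (snd z)) \<le> e * (Sup (snd z) - Inf (snd z))" by blast
  qed
  also have "\<dots> \<le> (\<Sum>z\<in>p. e * (Sup (snd z) - Inf (snd z)))"
  proof (rule sum_mono2[OF fin])
    fix z assume "z \<in> p - (p - q)"
    then have "(fst z, snd z) \<in> p" by auto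
    from piece[OF this] show "0 \<le> e * (Sup (snd z) - Inf (snd z))" using e(1) by simp
  qed auto
  also have "\<dots> = e * (\<Sum>z\<in>p. Sup (snd z) - Inf (snd z))"
    by (rule sum_distrib_left[symmetric])
  also have "(\<Sum>z\<in>p. Sup (snd z) - Inf (snd z)) = t - s"
    using additive_tagged_division_1[OF st p, of "\<lambda>x. x"] by (simp only: case_prod_unfold)
  finally have pq: "(\<Sum>z\<in>p - q. f (Sup (snd z)) - f (Inf (snd z))) \<le> e * (t - s)" .
  have "f t - f s = (\<Sum>z\<in>p. f (Sup (snd z)) - f (Inf (snd z)))"
    using additive_tagged_division_1[OF st p, of f] by (simp only: case_prod_unfold)
  also have "\<dots> = (\<Sum>z\<in>p - q. f (Sup (snd z)) - f (Inf (snd z))) + (\<Sum>z\<in>q. f (Sup (snd z)) - f (Inf (snd z)))"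
    using fin by (intro sum.subset_diff) (auto simp: q_def)
  also have "\<dots> < e * (t - s) + e" using q pq by simp
  finally show "f t \<le> f s + e0" using e(2) by simp
qed

lemma abs_continuous_on_antimono_on:
  assumes ac: "abs_continuous_on s t f"
    and deriv: "AE x in lebesgue. s < x \<and> x < t \<longrightarrow> (\<exists>D\<le>0. (f has_real_derivative D) (at x))"
    and xy: "s \<le> x" "x \<le> y" "y \<le> t"
  shows "f y \<le> f x"
proof (rule abs_continuous_on_antimono[OF _ xy(2)])
  show "abs_continuous_on x y f"
    using abs_continuous_on_subinterval ac xy by blast
  show "AE z in lebesgue. x < z \<and> z < y \<longrightarrow> (\<exists>D\<le>0. (f has_real_derivative D) (at z))"
    using deriv by eventually_elim (use xy in auto)
qed

section \<open>Solutions of Hill's equation\<close>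

lemma AE_lebesgue_translate:
  fixes P :: "real \<Rightarrow> bool"
  assumes "AE x in lebesgue. P x"
  shows "AE x in lebesgue. P (x + p)"
  unfolding AE_lebesgue_iff_negligible
proof (rule negligible_subset)
  show "negligible ((+) (- p) ` {x. \<not> P x})"
    using assms unfolding AE_lebesgue_iff_negligible by (rule negligible_translation)
  show "{x. \<not> P (x + p)} \<subseteq> (+) (- p) ` {x. \<not> P x}"
    by (auto intro!: image_eqI[where x = "_ + p"])
qed

text \<open>Working with the pair of a solution and its derivative keeps the equation closed under
  linear combinations and translations by a period.\<close>

definition solves_hill :: "(real \<Rightarrow> real) \<Rightarrow> (real \<Rightarrow> real) \<Rightarrow> (real \<Rightarrow> real) \<Rightarrow> bool" where
  "solves_hill a u v \<longleftrightarrow>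
     (\<forall>x. (u has_real_derivative v x) (at x)) \<and>
     (\<forall>s t. abs_continuous_on s t v) \<and>
     (AE x in lebesgue. (v has_real_derivative - a x * u x) (at x))"

lemma hill_solution_imp_solves_hill:
  assumes "hill_solution a u"
  shows "solves_hill a u (deriv u)"
  unfolding solves_hill_def
proof (intro conjI allI)
  show "(u has_real_derivative deriv u x) (at x)" for x
    using assms by (simp add: hill_solution_def DERIV_deriv_iff_real_differentiable)
  show "abs_continuous_on s t (deriv u)" for s t
    using assms by (simp add: hill_solution_def)
  have "AE x in lebesgue. deriv u differentiable (at x) \<and> deriv (deriv u) x + a x * u x = 0"
    using assms by (simp add: hill_solution_def)
  then show "AE x in lebesgue. (deriv u has_real_derivative - a x * u x) (at x)"
  proof eventually_elim
    case (elim x)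
    then have "(deriv u has_real_derivative deriv (deriv u) x) (at x)"
      by (simp add: DERIV_deriv_iff_real_differentiable)
    moreover have "deriv (deriv u) x = - a x * u x" using elim by simp
    ultimately show ?case by simp
  qed
qed

lemma solves_hill_DERIV: "solves_hill a u v \<Longrightarrow> (u has_real_derivative v x) (at x)"
  by (simp add: solves_hill_def)

lemma solves_hill_AC_deriv: "solves_hill a u v \<Longrightarrow> abs_continuous_on s t v"
  by (simp add: solves_hill_def)

lemma solves_hill_continuous_deriv:
  assumes "solves_hill a u v"
  shows "continuous_on A v"
proof -
  have "isCont v x" for x
  proof -
    have "continuous_on {x - 1..x + 1} v"
      using assms abs_continuous_on_imp_continuous_on solves_hill_AC_deriv by blast
    then show ?thesis
      by (rule continuous_on_interior) simp
  qed
  then show ?thesis by (simp add: continuous_at_imp_continuous_on)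
qed

lemma solves_hill_continuous: "solves_hill a u v \<Longrightarrow> continuous_on A u"
  by (meson DERIV_isCont continuous_at_imp_continuous_on solves_hill_DERIV)

lemma solves_hill_AC: "solves_hill a u v \<Longrightarrow> abs_continuous_on s t u"
  by (rule abs_continuous_on_C1[of s t u v])
     (auto intro: solves_hill_DERIV solves_hill_continuous_deriv)

lemma solves_hill_lincomb:
  assumes "solves_hill a u1 v1" "solves_hill a u2 v2"
  shows "solves_hill a (\<lambda>x. c * u1 x + d * u2 x) (\<lambda>x. c * v1 x + d * v2 x)"
  unfolding solves_hill_def
proof (intro conjI allI)
  show "((\<lambda>x. c * u1 x + d * u2 x) has_real_derivative c * v1 x + d * v2 x) (at x)" for x
    by (auto intro!: derivative_eq_intros assms[THEN solves_hill_DERIV])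
  show "abs_continuous_on s t (\<lambda>x. c * v1 x + d * v2 x)" for s t
    by (intro abs_continuous_on_add abs_continuous_on_cmult assms[THEN solves_hill_AC_deriv])
  have "AE x in lebesgue. (v1 has_real_derivative - a x * u1 x) (at x)"
    "AE x in lebesgue. (v2 has_real_derivative - a x * u2 x) (at x)"
    using assms by (auto simp: solves_hill_def)
  then show "AE x in lebesgue. ((\<lambda>x. c * v1 x + d * v2 x) has_real_derivative
      - a x * (c * u1 x + d * u2 x)) (at x)"
    by eventually_elim (auto intro!: derivative_eq_intros simp: algebra_simps)
qed

lemma solves_hill_shift:
  assumes u: "solves_hill a u v" and per: "\<And>x. a (x + p) = a x"
  shows "solves_hill a (\<lambda>x. u (x + p)) (\<lambda>x. v (x + p))"
  unfolding solves_hill_def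
proof (intro conjI allI)
  show "((\<lambda>x. u (x + p)) has_real_derivative v (x + p)) (at x)" for x
    using u by (simp add: solves_hill_DERIV flip: DERIV_shift)
  show "abs_continuous_on s t (\<lambda>x. v (x + p))" for s t
    using u by (intro abs_continuous_on_shift solves_hill_AC_deriv)
  have "AE x in lebesgue. (v has_real_derivative - a x * u x) (at x)"
    using u by (simp add: solves_hill_def)
  from AE_lebesgue_translate[OF this, of p]
  show "AE x in lebesgue. ((\<lambda>x. v (x + p)) has_real_derivative - a x * u (x + p)) (at x)"
    by eventually_elim (simp add: DERIV_shift per)
qed

lemma solves_hill_wronskian_const:
  assumes 1: "solves_hill a u1 v1" and 2: "solves_hill a u2 v2"
  shows "u1 x * v2 x - v1 x * u2 x = u1 y * v2 y - v1 y * u2 y"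
proof -
  define W where "W = (\<lambda>x. u1 x * v2 x - v1 x * u2 x)"
  have ac: "abs_continuous_on s t W" for s t
    unfolding W_def using assms
    by (intro abs_continuous_on_diff abs_continuous_on_mult) (auto intro: solves_hill_AC solves_hill_AC_deriv)
  have ac': "abs_continuous_on s t (\<lambda>x. (-1) * W x)" for s t
    by (intro abs_continuous_on_cmult ac)
  have "AE x in lebesgue. (v1 has_real_derivative - a x * u1 x) (at x)"
    "AE x in lebesgue. (v2 has_real_derivative - a x * u2 x) (at x)"
    using assms by (auto simp: solves_hill_def)
  then have W': "AE x in lebesgue. (W has_real_derivative 0) (at x)"
  proof eventually_elim
    case (elim x)
    show ?case
      unfolding W_def
      using DERIV_diff[OF DERIV_mult[OF solves_hill_DERIV[OF 1] elim(2)]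
          DERIV_mult[OF elim(1) solves_hill_DERIV[OF 2]]]
      by (simp add: algebra_simps)
  qed
  have "W t = W s" if "s \<le> t" for s t
  proof (rule antisym)
    show "W t \<le> W s"
      using W' by (intro abs_continuous_on_antimono[OF ac that]) (auto elim!: eventually_mono)
    have "(-1) * W t \<le> (-1) * W s"
    proof (rule abs_continuous_on_antimono[OF ac' that])
      show "AE x in lebesgue. s < x \<and> x < t \<longrightarrow> (\<exists>D\<le>0. ((\<lambda>x. (-1) * W x) has_real_derivative D) (at x))"
        using W' by eventually_elim (auto dest: DERIV_minus intro!: exI[of _ 0])
    qed
    then show "W s \<le> W t" by simp
  qed
  then have "W x = W y" by (metis linear)
  then show ?thesis by (simp add: W_def)
qed

text \<open>Gronwall's argument: the relative growth rate of \<open>u\<^sup>2 + v\<^sup>2\<close> is at most \<open>1 + K\<close> in both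
  directions of time, so the energy vanishes everywhere if it vanishes once.\<close>

lemma solves_hill_unique:
  assumes u: "solves_hill a u v" and K: "AE x in lebesgue. \<bar>a x\<bar> \<le> K"
    and 0: "u x0 = 0" "v x0 = 0"
  shows "u x = 0" "v x = 0"
proof -
  define E where "E = (\<lambda>x. u x * u x + v x * v x)"
  have AE: "AE x in lebesgue. (v has_real_derivative - a x * u x) (at x) \<and> \<bar>a x\<bar> \<le> K"
    using u K by (auto simp: solves_hill_def)
  have acE: "abs_continuous_on s t E" for s t
    unfolding E_def using u
    by (intro abs_continuous_on_add abs_continuous_on_mult) (auto intro: solves_hill_AC solves_hill_AC_deriv)
  have expd: "((\<lambda>x. exp (c * x)) has_real_derivative c * exp (c * z)) (at z)" for c z :: real
    by (auto intro!: derivative_eq_intros)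
  have acx: "abs_continuous_on s t (\<lambda>x. exp (c * x))" for s t c
    by (rule abs_continuous_on_C1[OF expd]) (intro continuous_intros)
  have rate: "\<bar>2 * u z * v z * (1 - a z)\<bar> \<le> (1 + K) * E z" if "\<bar>a z\<bar> \<le> K" for z
  proof -
    have "\<bar>2 * u z * v z\<bar> \<le> E z"
      using sum_squares_bound[of "\<bar>u z\<bar>" "\<bar>v z\<bar>"] by (simp add: E_def power2_eq_square abs_mult)
    moreover have "\<bar>1 - a z\<bar> \<le> 1 + K" using that by linarith
    ultimately have "\<bar>2 * u z * v z\<bar> * \<bar>1 - a z\<bar> \<le> E z * (1 + K)"
      by (intro mult_mono) auto
    then show ?thesis by (simp add: abs_mult mult.commute)
  qed
  have E': "(E has_real_derivative 2 * u z * v z * (1 - a z)) (at z)"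
    if "(v has_real_derivative - a z * u z) (at z)" for z
    unfolding E_def using that
    by (auto intro!: derivative_eq_intros solves_hill_DERIV[OF u] simp: algebra_simps)
  have "E x \<le> 0"
  proof (cases "x0 \<le> x")
    case True
    have "E x * exp (- (1 + K) * x) \<le> E x0 * exp (- (1 + K) * x0)"
    proof (rule abs_continuous_on_antimono[OF abs_continuous_on_mult[OF acE acx] True])
      show "AE z in lebesgue. x0 < z \<and> z < x \<longrightarrow>
          (\<exists>D\<le>0. ((\<lambda>x. E x * exp (- (1 + K) * x)) has_real_derivative D) (at z))"
        using AE
      proof eventually_elim
        case (elim z)
        have "((\<lambda>x. E x * exp (- (1 + K) * x)) has_real_derivative
            (2 * u z * v z * (1 - a z) - (1 + K) * E z) * exp (- (1 + K) * z)) (at z)"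
          using DERIV_mult[OF E'[of z] expd[of "- (1 + K)" z]] elim by (simp add: algebra_simps)
        moreover have "(2 * u z * v z * (1 - a z) - (1 + K) * E z) * exp (- (1 + K) * z) \<le> 0"
          using rate[of z] elim by (intro mult_nonpos_nonneg) auto
        ultimately show ?case by blast
      qed
    qed
    then show ?thesis using 0 by (simp add: E_def mult_le_0_iff)
  next
    case False
    then have "x \<le> x0" by simp
    have "(-1) * (E x0 * exp ((1 + K) * x0)) \<le> (-1) * (E x * exp ((1 + K) * x))"
    proof (rule abs_continuous_on_antimono
        [OF abs_continuous_on_cmult[OF abs_continuous_on_mult[OF acE acx]] \<open>x \<le> x0\<close>])
      show "AE z in lebesgue. x < z \<and> z < x0 \<longrightarrow>
          (\<exists>D\<le>0. ((\<lambda>x. (-1) * (E x * exp ((1 + K) * x))) has_real_derivative D) (at z))"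
        using AE
      proof eventually_elim
        case (elim z)
        have "((\<lambda>x. (-1) * (E x * exp ((1 + K) * x))) has_real_derivative
            - ((2 * u z * v z * (1 - a z) + (1 + K) * E z) * exp ((1 + K) * z))) (at z)"
          using DERIV_cmult[OF DERIV_mult[OF E'[of z] expd[of "1 + K" z]], of "-1"] elim
          by (simp add: algebra_simps)
        moreover have "(2 * u z * v z * (1 - a z) + (1 + K) * E z) * exp ((1 + K) * z) \<ge> 0"
          using rate[of z] elim by (intro mult_nonneg_nonneg) auto
        ultimately show ?case by (metis neg_le_0_iff_le)
      qed
    qed
    then show ?thesis using 0 by (simp add: E_def mult_le_0_iff)
  qed
  moreover have "u x * u x \<ge> 0" "v x * v x \<ge> 0" by auto
  ultimately have "u x * u x = 0" "v x * v x = 0" unfolding E_def by linarith+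
  then show "u x = 0" "v x = 0" by auto
qed

section \<open>Comparison with a step function\<close>

text \<open>The logarithmic derivative \<open>w\<close> of the comparison function \<open>cos (\<theta> - \<omega> (x - l))\<close> satisfies
  \<open>w' = - \<omega>\<^sup>2 - w\<^sup>2\<close>.  The quantity \<open>w u\<^sup>2 - u u'\<close> therefore decreases along a solution with
  \<open>a \<le> \<omega>\<^sup>2\<close>, and it depends on \<open>w\<close> only through its value, so that pieces with different \<open>\<omega>\<close> can be
  chained by matching \<open>\<omega> tan \<theta>\<close> at the breakpoints.\<close>

lemma picone_piece:
  assumes u: "solves_hill a u v" and lr: "l \<le> r"
    and \<theta>: "\<theta> < pi / 2" "- (pi / 2) < \<theta> - \<omega> * (r - l)" and \<omega>: "\<omega> > 0"
    and a: "AE x in lebesgue. l < x \<and> x < r \<longrightarrow> a x \<le> \<omega>\<^sup>2"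
  shows "\<omega> * tan (\<theta> - \<omega> * (r - l)) * (u r)\<^sup>2 - u r * v r \<le> \<omega> * tan \<theta> * (u l)\<^sup>2 - u l * v l" (is ?le)
    and "u l = 0 \<Longrightarrow> \<omega> * tan (\<theta> - \<omega> * (r - l)) * (u r)\<^sup>2 - u r * v r = 0 \<Longrightarrow> x \<in> {l..r} \<Longrightarrow> u x = 0"
proof -
  define \<phi> where "\<phi> = (\<lambda>x. \<theta> - \<omega> * (x - l))"
  define w where "w = (\<lambda>x. \<omega> * tan (\<phi> x))"
  define F where "F = (\<lambda>x. w x * (u x * u x) - u x * v x)"
  have cos_pos: "cos (\<phi> x) > 0" if "x \<in> {l..r}" for x
  proof (rule cos_gt_zero_pi)
    have "0 \<le> \<omega> * (x - l)" "\<omega> * (x - l) \<le> \<omega> * (r - l)"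
      using that \<omega> by (auto intro: mult_left_mono)
    then show "- (pi / 2) < \<phi> x" "\<phi> x < pi / 2"
      using \<theta> unfolding \<phi>_def by linarith+
  qed
  have d\<phi>: "(\<phi> has_real_derivative - \<omega>) (at x)" for x
    unfolding \<phi>_def by (auto intro!: derivative_eq_intros)
  have dw: "(w has_real_derivative - \<omega>\<^sup>2 - (w x)\<^sup>2) (at x)" if "x \<in> {l..r}" for x
  proof -
    have c: "cos (\<phi> x) \<noteq> 0" using cos_pos[OF that] by simp
    have "((\<lambda>x. tan (\<phi> x)) has_real_derivative inverse ((cos (\<phi> x))\<^sup>2) * - \<omega>) (at x)"
      by (rule DERIV_chain2[OF DERIV_tan[OF c] d\<phi>])
    then have "(w has_real_derivative \<omega> * (inverse ((cos (\<phi> x))\<^sup>2) * - \<omega>)) (at x)"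
      unfolding w_def by (rule DERIV_cmult)
    moreover have "inverse ((cos (\<phi> x))\<^sup>2) = 1 + (tan (\<phi> x))\<^sup>2"
      using tan_sec[OF c] by (simp only: power_inverse)
    then have "\<omega> * (inverse ((cos (\<phi> x))\<^sup>2) * - \<omega>) = - \<omega>\<^sup>2 - (w x)\<^sup>2"
      by (simp add: w_def power2_eq_square algebra_simps)
    ultimately show ?thesis by simp
  qed
  have cw: "continuous_on {l..r} w"
    by (meson DERIV_isCont continuous_at_imp_continuous_on dw)
  have acw: "abs_continuous_on l r w"
    by (rule abs_continuous_on_C1[OF dw]) (auto intro!: continuous_intros cw)
  have acF: "abs_continuous_on l r F"
    unfolding F_def using u acw
    by (intro abs_continuous_on_diff abs_continuous_on_mult)
      (auto intro: solves_hill_AC solves_hill_AC_deriv)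
  have AE: "AE x in lebesgue. (v has_real_derivative - a x * u x) (at x) \<and> (l < x \<and> x < r \<longrightarrow> a x \<le> \<omega>\<^sup>2)"
    using u a by (auto simp: solves_hill_def)
  \<comment> \<open>Picone's identity: the derivative of \<open>F\<close> is minus a square plus a nonpositive term.\<close>
  have dF: "AE x in lebesgue. l < x \<and> x < r \<longrightarrow> (\<exists>D\<le>0. (F has_real_derivative D) (at x))"
    using AE
  proof eventually_elim
    case (elim x)
    show ?case
    proof
      assume x: "l < x \<and> x < r"
      then have xlr: "x \<in> {l..r}" by simp
      have du: "(u has_real_derivative v x) (at x)" using u by (rule solves_hill_DERIV)
      have dv: "(v has_real_derivative - a x * u x) (at x)" using elim by simp
      have "(F has_real_derivative - (v x - w x * u x)\<^sup>2 + (a x - \<omega>\<^sup>2) * (u x)\<^sup>2) (at x)"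
        unfolding F_def
        using DERIV_diff[OF DERIV_mult[OF dw[OF xlr] DERIV_mult[OF du du]] DERIV_mult[OF du dv]]
        by (rule DERIV_cong) (simp add: power2_eq_square algebra_simps)
      moreover have "- (v x - w x * u x)\<^sup>2 + (a x - \<omega>\<^sup>2) * (u x)\<^sup>2 \<le> 0"
        using elim x by (intro add_nonpos_nonpos mult_nonpos_nonneg) auto
      ultimately show "\<exists>D\<le>0. (F has_real_derivative D) (at x)" by blast
    qed
  qed
  have Fmono: "F y \<le> F x" if "l \<le> x" "x \<le> y" "y \<le> r" for x y
    using abs_continuous_on_antimono_on[OF acF dF that] .
  have Fl: "F l = \<omega> * tan \<theta> * (u l)\<^sup>2 - u l * v l"
    and Fr: "F r = \<omega> * tan (\<theta> - \<omega> * (r - l)) * (u r)\<^sup>2 - u r * v r"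
    by (simp_all add: F_def w_def \<phi>_def power2_eq_square)
  show ?le using Fmono[of l r] lr Fl Fr by simp
  show "u x = 0" if 0: "u l = 0" "\<omega> * tan (\<theta> - \<omega> * (r - l)) * (u r)\<^sup>2 - u r * v r = 0" and x: "x \<in> {l..r}"
  proof -
    have F0: "F z = 0" if "z \<in> {l..r}" for z
      using Fmono[of l z] Fmono[of z r] 0 Fl Fr that by simp
    \<comment> \<open>Equality forces \<open>u\<close> to be a multiple of the positive comparison function \<open>cos \<circ> \<phi>\<close>.\<close>
    have "((\<lambda>x. (u x / cos (\<phi> x))\<^sup>2) has_real_derivative 0) (at z)" if z: "z \<in> {l..r}" for z
    proof -
      have c: "cos (\<phi> z) \<noteq> 0" using cos_pos[OF z] by simp
      have du: "(u has_real_derivative v z) (at z)" using u by (rule solves_hill_DERIV)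
      have dc: "((\<lambda>x. cos (\<phi> x)) has_real_derivative - sin (\<phi> z) * - \<omega>) (at z)"
        by (rule DERIV_chain2[OF DERIV_cos d\<phi>])
      have "u z * (v z * cos (\<phi> z) - u z * (\<omega> * sin (\<phi> z))) = - cos (\<phi> z) * F z"
        using c by (simp add: F_def w_def tan_def field_simps)
      then have 1: "u z * (v z * cos (\<phi> z) - u z * (\<omega> * sin (\<phi> z))) = 0" using F0[OF z] by simp
      have "((\<lambda>x. (u x / cos (\<phi> x))\<^sup>2) has_real_derivative
         2 * (u z / cos (\<phi> z)) * ((v z * cos (\<phi> z) - u z * (- sin (\<phi> z) * - \<omega>)) / (cos (\<phi> z) * cos (\<phi> z)))) (at z)"
        using DERIV_power[OF DERIV_divide[OF du dc c], of 2] by (rule DERIV_cong) (simp add: algebra_simps)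
      moreover have "2 * (u z / cos (\<phi> z)) * ((v z * cos (\<phi> z) - u z * (- sin (\<phi> z) * - \<omega>)) / (cos (\<phi> z) * cos (\<phi> z)))
        = 2 * (u z * (v z * cos (\<phi> z) - u z * (\<omega> * sin (\<phi> z)))) / (cos (\<phi> z) * cos (\<phi> z) * cos (\<phi> z))"
        by (simp add: mult.commute)
      ultimately show ?thesis by (simp only: 1 mult_zero_right div_0)
    qed
    then have "\<exists>k. \<forall>z\<in>{l..r}. (u z / cos (\<phi> z))\<^sup>2 = k"
      by (intro has_field_derivative_zero_constant) (auto intro: has_field_derivative_at_within)
    then have "(u x / cos (\<phi> x))\<^sup>2 = (u l / cos (\<phi> l))\<^sup>2"
      using x lr by (metis atLeastAtMost_iff order_refl)
    then show "u x = 0" using 0 cos_pos[OF x] by simp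
  qed
qed

lemma arctan_add_less_pi_half:
  assumes "0 \<le> \<phi>" "\<phi> < pi / 2" "T * tan \<phi> < 1"
  shows "arctan T + \<phi> < pi / 2"
proof (cases "\<phi> = 0")
  case True
  then show ?thesis using arctan_ubound by simp
next
  case False
  then have t: "tan \<phi> > 0" using assms tan_gt_zero by simp
  have "T < inverse (tan \<phi>)" using assms t by (simp add: field_simps)
  also have "\<dots> = tan (pi / 2 - \<phi>)" by (simp add: tan_cot)
  finally have "arctan T < arctan (tan (pi / 2 - \<phi>))" by (simp add: arctan_less_iff)
  also have "\<dots> = pi / 2 - \<phi>" using assms False by (intro arctan_tan) auto
  finally show ?thesis by simp
qed

text \<open>The outer pieces carry the phases \<open>\<phi>L\<close> and \<open>\<phi>R\<close> with \<open>\<phi>L + \<phi>R = \<alpha>\<close>.  On the middle piece the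
  comparison cosine is chosen to run from phase \<open>\<phi>R\<close> down to \<open>- \<phi>L\<close>, that is, with the two outer
  phases interchanged: then continuing it to the left and to the right without
  a zero is one and the same condition, \<open>\<omega>2 tan \<phi>L tan \<phi>R < \<omega>1\<close>.  By the addition formulas this
  amounts to \<open>cos (\<phi>L - \<phi>R) (L1 - L2) < cos \<alpha> (L1 + L2)\<close>, where \<open>L1\<close> is the total outer length and
  \<open>L2\<close> the inner one; it is trivial for \<open>L1 \<le> L2\<close>, and otherwise
  its worst case \<open>\<phi>L = \<phi>R\<close> is the hypothesis \<open>gap\<close>.\<close>

lemma hill_disconjugate:
  assumes u: "solves_hill a u v" and K: "AE x in lebesgue. \<bar>a x\<bar> \<le> K"
    and ord: "c \<le> y1" "y1 < y2" "y2 \<le> d" and \<omega>: "\<omega>1 > 0" "\<omega>2 > 0"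
    and L: "\<omega>1 * ((y1 - c) + (d - y2)) = \<alpha>" "\<omega>2 * (y2 - y1) = \<alpha>" and \<alpha>: "\<alpha> < pi / 2"
    and gap: "(y1 - c) + (d - y2) - (y2 - y1) < cos \<alpha> * (d - c)"
    and a1: "AE x in lebesgue. c < x \<and> x < y1 \<longrightarrow> a x \<le> \<omega>1\<^sup>2"
    and a2: "AE x in lebesgue. y1 < x \<and> x < y2 \<longrightarrow> a x \<le> \<omega>2\<^sup>2"
    and a3: "AE x in lebesgue. y2 < x \<and> x < d \<longrightarrow> a x \<le> \<omega>1\<^sup>2"
    and zero: "u c = 0" "u d = 0"
  shows "u x = 0"
proof -
  define L1 L2 where "L1 = (y1 - c) + (d - y2)" and "L2 = y2 - y1"
  define \<phi>L \<phi>R where "\<phi>L = \<omega>1 * (y1 - c)" and "\<phi>R = \<omega>1 * (d - y2)"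
  have "\<alpha> > 0" using L(2) ord \<omega> by (metis diff_gt_0_iff_gt mult_pos_pos)
  then have L1: "L1 > 0" using L(1) \<omega> unfolding L1_def by (metis zero_less_mult_pos)
  have L2: "L2 > 0" using ord by (simp add: L2_def)
  have \<phi>: "\<phi>L \<ge> 0" "\<phi>R \<ge> 0" "\<phi>L + \<phi>R = \<alpha>"
    using ord \<omega> L(1) by (auto simp: \<phi>L_def \<phi>R_def distrib_left)
  then have \<phi>2: "\<phi>L < pi / 2" "\<phi>R < pi / 2" using \<alpha> by auto
  have c: "cos \<phi>L > 0" "cos \<phi>R > 0" using \<phi> \<phi>2 by (auto intro!: cos_gt_zero_pi)
  have key: "\<omega>2 * tan \<phi>L * tan \<phi>R < \<omega>1"
  proof -
    define s where "s = sin \<phi>L * sin \<phi>R"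
    define k where "k = cos \<phi>L * cos \<phi>R"
    have k: "k > 0" using c by (simp add: k_def)
    have cd: "cos (\<phi>L - \<phi>R) = k + s" "cos \<alpha> = k - s"
      unfolding \<phi>(3)[symmetric] by (simp_all add: cos_diff cos_add k_def s_def)
    have "0 \<le> s" using \<phi> \<phi>2 by (auto simp: s_def intro!: mult_nonneg_nonneg sin_ge_zero)
    then have pos: "0 < k + s" "k + s \<le> 1" using k cos_le_one[of "\<phi>L - \<phi>R"] cd by auto
    have "0 < cos \<alpha>" using \<alpha> \<open>\<alpha> > 0\<close> by (intro cos_gt_zero_pi) auto
    have g: "L1 - L2 < cos \<alpha> * (L1 + L2)" using gap by (simp add: L1_def L2_def algebra_simps)
    have "(k + s) * (L1 - L2) < cos \<alpha> * (L1 + L2)"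
    proof (cases "L1 \<le> L2")
      case True
      then have "(k + s) * (L1 - L2) \<le> 0" using pos by (simp add: mult_nonneg_nonpos)
      moreover have "0 < cos \<alpha> * (L1 + L2)" using \<open>0 < cos \<alpha>\<close> L1 L2 by simp
      ultimately show ?thesis by simp
    next
      case False
      then have "(k + s) * (L1 - L2) \<le> 1 * (L1 - L2)" using pos by (intro mult_right_mono) auto
      then show ?thesis using g by simp
    qed
    then have "L1 * s < L2 * k" unfolding cd by (simp add: algebra_simps)
    then have "\<omega>2 * (L1 * s) < \<omega>2 * (L2 * k)" using \<omega> by simp
    also have "\<dots> = (\<omega>2 * L2) * k" by simp
    also have "\<omega>2 * L2 = \<omega>1 * L1" using L by (simp add: L1_def L2_def)
    finally have "L1 * (\<omega>2 * s) < L1 * (\<omega>1 * k)" by (simp add: algebra_simps)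
    then have "\<omega>2 * s < \<omega>1 * k" using L1 by simp
    then have "\<omega>2 * s / k < \<omega>1" using k by (simp add: field_simps)
    then show ?thesis by (simp add: s_def k_def tan_def)
  qed
  \<comment> \<open>Phases of the outer cosines at the breakpoints, from matching the logarithmic derivatives.\<close>
  define sL sR where "sL = arctan (\<omega>2 * tan \<phi>R / \<omega>1)" and "sR = arctan (\<omega>2 * tan \<phi>L / \<omega>1)"
  have sL: "sL + \<phi>L < pi / 2" "- (pi / 2) < sL" "\<omega>1 * tan sL = \<omega>2 * tan \<phi>R"
  proof -
    have "\<omega>2 * tan \<phi>R / \<omega>1 * tan \<phi>L < 1" using key \<omega> by (simp add: field_simps)
    then show "sL + \<phi>L < pi / 2"
      using arctan_add_less_pi_half \<phi> \<phi>2 unfolding sL_def by blast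
    show "- (pi / 2) < sL" unfolding sL_def by (rule arctan_lbound)
    show "\<omega>1 * tan sL = \<omega>2 * tan \<phi>R" using \<omega> by (simp add: sL_def tan_arctan)
  qed
  have sR: "sR + \<phi>R < pi / 2" "- (pi / 2) < sR" "\<omega>1 * tan sR = \<omega>2 * tan \<phi>L"
  proof -
    have "\<omega>2 * tan \<phi>L / \<omega>1 * tan \<phi>R < 1" using key \<omega> by (simp add: field_simps)
    then show "sR + \<phi>R < pi / 2"
      using arctan_add_less_pi_half \<phi> \<phi>2 unfolding sR_def by blast
    show "- (pi / 2) < sR" unfolding sR_def by (rule arctan_lbound)
    show "\<omega>1 * tan sR = \<omega>2 * tan \<phi>L" using \<omega> by (simp add: sR_def tan_arctan)
  qed
  have e1: "sL + \<phi>L - \<omega>1 * (y1 - c) = sL" by (simp add: \<phi>L_def)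
  have e2: "\<phi>R - \<omega>2 * (y2 - y1) = - \<phi>L" using \<phi>(3) L(2) by simp
  have e3: "- sR - \<omega>1 * (d - y2) = - sR - \<phi>R" by (simp add: \<phi>R_def)
  have p1: "- (pi / 2) < sL + \<phi>L - \<omega>1 * (y1 - c)" using sL e1 by simp
  have p2: "- (pi / 2) < \<phi>R - \<omega>2 * (y2 - y1)" using \<phi>2 e2 by simp
  have p3: "- sR < pi / 2" "- (pi / 2) < - sR - \<omega>1 * (d - y2)" using sR e3 by auto
  define q1 where "q1 = \<omega>2 * tan \<phi>R * (u y1)\<^sup>2 - u y1 * v y1"
  define q2 where "q2 = - (\<omega>2 * tan \<phi>L) * (u y2)\<^sup>2 - u y2 * v y2"
  have "q1 \<le> 0"
    using picone_piece(1)[OF u ord(1) sL(1) p1 \<omega>(1) a1] zero unfolding e1 sL q1_def by simp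
  moreover have "q2 \<le> q1"
    using picone_piece(1)[OF u less_imp_le[OF ord(2)] \<phi>2(2) p2 \<omega>(2) a2]
    unfolding e2 q1_def q2_def by simp
  moreover have "0 \<le> q2"
    using picone_piece(1)[OF u ord(3) p3 \<omega>(1) a3] zero sR(3) unfolding e3 q2_def by simp
  ultimately have q: "q1 = 0" "q2 = 0" by auto
  have "u y1 = 0"
    using picone_piece(2)[OF u ord(1) sL(1) p1 \<omega>(1) a1, of y1] zero q(1) ord unfolding e1 sL q1_def by simp
  then have 0: "u z = 0" if "z \<in> {y1..y2}" for z
    using picone_piece(2)[OF u less_imp_le[OF ord(2)] \<phi>2(2) p2 \<omega>(2) a2, of z] that q(2)
    unfolding e2 q2_def by simp
  \<comment> \<open>The middle piece has positive length, so \<open>u\<close> vanishes to first order inside it.\<close>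
  define m where "m = (y1 + y2) / 2"
  have "v m = 0"
  proof (rule DERIV_local_const[OF solves_hill_DERIV[OF u]])
    show "0 < (y2 - y1) / 2" using ord by simp
    show "\<forall>y. \<bar>m - y\<bar> < (y2 - y1) / 2 \<longrightarrow> u m = u y"
      using ord by (auto simp: m_def abs_less_iff field_simps intro!: trans[OF 0 0[symmetric]])
  qed
  moreover have "u m = 0" using ord by (intro 0) (auto simp: m_def)
  ultimately show ?thesis using solves_hill_unique(1)[OF u K] by blast
qed

section \<open>Real multipliers and stability\<close>

lemma periodic_int_mult:
  fixes f :: "real \<Rightarrow> 'b"
  assumes "\<And>x. f (x + p) = f x"
  shows "f (x + of_int n * p) = f x"
proof (induction n rule: int_induct[where k = 0])
  case (step1 i)
  then show ?case using assms[of "x + of_int i * p"] by (simp add: algebra_simps)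
next
  case (step2 i)
  then show ?case using assms[of "x + of_int (i - 1) * p"] by (simp add: algebra_simps)
qed simp

lemma ex_int_multiple_in_period:
  fixes p :: real
  assumes "p > 0"
  obtains n :: int where "of_int n * p \<le> x" "x < of_int n * p + p"
proof
  show "of_int \<lfloor>x / p\<rfloor> * p \<le> x"
    using assms by (meson of_int_floor_le pos_le_divide_eq)
  have "x / p < of_int \<lfloor>x / p\<rfloor> + 1" by linarith
  then have "x < (of_int \<lfloor>x / p\<rfloor> + 1) * p"
    using assms by (simp only: pos_divide_less_eq)
  then show "x < of_int \<lfloor>x / p\<rfloor> * p + p" by (simp add: distrib_right)
qed

lemma periodic_continuous_imp_bounded:
  fixes f :: "real \<Rightarrow> real"
  assumes "continuous_on UNIV f" "\<And>x. f (x + p) = f x" "p > 0"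
  shows "bounded (range f)"
proof (rule bounded_subset)
  show "bounded (f ` {0..p})"
    using assms(1) by (meson compact_Icc compact_continuous_image compact_imp_bounded continuous_on_subset subset_UNIV)
  show "range f \<subseteq> f ` {0..p}"
  proof
    fix y assume "y \<in> range f"
    then obtain x where "y = f x" by blast
    obtain n :: int where n: "of_int n * p \<le> x" "x < of_int n * p + p"
      using ex_int_multiple_in_period[OF assms(3)] .
    have "y = f (x + of_int (- n) * p)"
      using \<open>y = f x\<close> periodic_int_mult[of f p x "- n", OF assms(2)] by simp
    then show "y \<in> f ` {0..p}" using n by (intro image_eqI) auto
  qed
qed

text \<open>For \<open>\<bar>A\<bar> < 2\<close> the recurrence preserves the positive definite quadratic form
  \<open>X\<^sup>2 - A X Y + Y\<^sup>2\<close> of \<open>X = f (x + p)\<close> and \<open>Y = f x\<close>, which is thus periodic and bounded.\<close>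

lemma bounded_of_elliptic_recurrence:
  fixes f :: "real \<Rightarrow> real"
  assumes cont: "continuous_on UNIV f" and p: "p > 0" and A: "\<bar>A\<bar> < 2"
    and rec: "\<And>x. f (x + p + p) = A * f (x + p) - f x"
  shows "bounded (range f)"
proof -
  define Q where "Q = (\<lambda>x. (f (x + p))\<^sup>2 - A * f (x + p) * f x + (f x)\<^sup>2)"
  have "Q (x + p) = Q x" for x
    unfolding Q_def rec by (simp add: power2_eq_square algebra_simps)
  moreover have "continuous_on UNIV Q"
    unfolding Q_def by (intro continuous_intros continuous_on_compose2[OF cont]) auto
  ultimately have "bounded (range Q)" using periodic_continuous_imp_bounded p by blast
  then obtain B where B: "\<And>x. \<bar>Q x\<bar> \<le> B" unfolding bounded_iff by auto
  define e where "e = 1 - \<bar>A\<bar> / 2"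
  have e: "e > 0" using A by (simp add: e_def)
  have "\<bar>f x\<bar> \<le> sqrt (B / e)" for x
  proof -
    have "\<bar>f (x + p) * f x\<bar> \<le> ((f (x + p))\<^sup>2 + (f x)\<^sup>2) / 2"
      using sum_squares_bound[of "\<bar>f (x + p)\<bar>" "\<bar>f x\<bar>"] by (simp add: abs_mult)
    then have "\<bar>A\<bar> * \<bar>f (x + p) * f x\<bar> \<le> \<bar>A\<bar> * (((f (x + p))\<^sup>2 + (f x)\<^sup>2) / 2)"
      by (rule mult_left_mono) simp
    then have "A * f (x + p) * f x \<le> \<bar>A\<bar> * (((f (x + p))\<^sup>2 + (f x)\<^sup>2) / 2)"
      by (metis abs_ge_self abs_mult mult.assoc order_trans)
    then have "e * ((f (x + p))\<^sup>2 + (f x)\<^sup>2) \<le> Q x"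
      unfolding Q_def e_def by (simp add: algebra_simps)
    moreover have "e * (f x)\<^sup>2 \<le> e * ((f (x + p))\<^sup>2 + (f x)\<^sup>2)" using e by simp
    ultimately have "e * (f x)\<^sup>2 \<le> B" using B[of x] by linarith
    then have "(f x)\<^sup>2 \<le> B / e" using e by (simp add: field_simps)
    then show ?thesis by (metis real_sqrt_abs real_sqrt_le_mono)
  qed
  then show ?thesis unfolding bounded_iff by auto
qed

text \<open>The Wronskian \<open>W\<close> of \<open>u\<close> and its translate is nonzero, since otherwise the translate would be
  a multiple of \<open>u\<close>.  So the second translate is a combination of the two; because \<open>W\<close> is the same
  for the first and second translate, the coefficient of \<open>u\<close> is \<open>-1\<close>.\<close>

lemma stable_if_no_real_multiplier:
  assumes per: "\<And>x. a (x + p) = a x" and p: "p > 0" and K: "AE x in lebesgue. \<bar>a x\<bar> \<le> K"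
    and nomult: "\<And>u v \<rho>. solves_hill a u v \<Longrightarrow> (\<And>x. u (x + p) = \<rho> * u x) \<Longrightarrow> (\<And>x. u x = 0)"
    and u: "solves_hill a u v"
  shows "bounded (range u) \<and> bounded (range v)"
proof -
  define u1 v1 u2 v2 where "u1 = (\<lambda>x. u (x + p))" and "v1 = (\<lambda>x. v (x + p))"
    and "u2 = (\<lambda>x. u (x + p + p))" and "v2 = (\<lambda>x. v (x + p + p))"
  have s1: "solves_hill a u1 v1" unfolding u1_def v1_def by (rule solves_hill_shift[OF u per])
  have s2: "solves_hill a u2 v2"
    using solves_hill_shift[OF s1 per] unfolding u1_def v1_def u2_def v2_def by simp
  define W where "W = u 0 * v1 0 - v 0 * u1 0"
  have W2: "W = u1 0 * v2 0 - v1 0 * u2 0"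
    using solves_hill_wronskian_const[OF u s1, of 0 p] unfolding W_def u1_def v1_def u2_def v2_def
    by simp
  show ?thesis
  proof (cases "u 0 = 0 \<and> v 0 = 0")
    case True
    then have "u = (\<lambda>_. 0)" "v = (\<lambda>_. 0)" using solves_hill_unique[OF u K, of 0] by auto
    then show ?thesis by simp
  next
    case nz: False
    have "W \<noteq> 0"
    proof
      assume W0: "W = 0"
      \<comment> \<open>\<open>\<rho>\<close> is the projection coefficient, which avoids a case distinction on which of \<open>u 0\<close>, \<open>v 0\<close> vanishes.\<close>
      define n \<rho> where "n = (u 0)\<^sup>2 + (v 0)\<^sup>2" and "\<rho> = (u 0 * u1 0 + v 0 * v1 0) / n"
      have n: "n \<noteq> 0" using nz by (simp add: n_def sum_power2_eq_zero_iff)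
      have "n * u1 0 = (u 0 * u1 0 + v 0 * v1 0) * u 0" "n * v1 0 = (u 0 * u1 0 + v 0 * v1 0) * v 0"
        using W0 unfolding n_def W_def power2_eq_square by algebra+
      then have "u1 0 = \<rho> * u 0" "v1 0 = \<rho> * v 0" using n by (simp_all add: \<rho>_def field_simps)
      then have "1 * u1 x + - \<rho> * u x = 0" for x
        using solves_hill_unique(1)[OF solves_hill_lincomb[OF s1 u, of 1 "- \<rho>"] K, of 0 x] by simp
      then have "u (x + p) = \<rho> * u x" for x by (simp add: u1_def)
      from nomult[OF u this] have "u x = 0" for x .
      moreover from this have "v 0 = 0"
        by (intro DERIV_local_const[OF solves_hill_DERIV[OF u], of 1]) auto
      ultimately show False using nz by simp
    qed
    define A where "A = (u 0 * v2 0 - v 0 * u2 0) / W"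
    have AW: "A * W = u 0 * v2 0 - v 0 * u2 0" using \<open>W \<noteq> 0\<close> by (simp add: A_def)
    have "W * u2 0 = W * (A * u1 0 - u 0)" "W * v2 0 = W * (A * v1 0 - v 0)"
    proof -
      have *: "W * (A * y1 - y0) = (u 0 * v2 0 - v 0 * u2 0) * y1 - (u1 0 * v2 0 - v1 0 * u2 0) * y0" for y0 y1
      proof -
        have "W * (A * y1 - y0) = (A * W) * y1 - W * y0" by (simp add: algebra_simps)
        then show ?thesis unfolding AW unfolding W2 .
      qed
      show "W * u2 0 = W * (A * u1 0 - u 0)" "W * v2 0 = W * (A * v1 0 - v 0)"
        unfolding * by (simp_all add: W_def algebra_simps)
    qed
    then have "1 * u2 0 + - 1 * (A * u1 0 + - 1 * u 0) = 0" "1 * v2 0 + - 1 * (A * v1 0 + - 1 * v 0) = 0"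
      using \<open>W \<noteq> 0\<close> by auto
    from solves_hill_unique[OF solves_hill_lincomb[OF s2 solves_hill_lincomb[OF s1 u, of A "- 1"], of 1 "- 1"] K this]
    have "1 * u2 x + - 1 * (A * u1 x + - 1 * u x) = 0" "1 * v2 x + - 1 * (A * v1 x + - 1 * v x) = 0" for x .
    then have rec: "u (x + p + p) = A * u (x + p) - u x" "v (x + p + p) = A * v (x + p) - v x" for x
      unfolding u1_def u2_def v1_def v2_def by (smt (verit))+
    have "\<bar>A\<bar> < 2"
    proof (rule ccontr)
      assume "\<not> \<bar>A\<bar> < 2"
      then have "2\<^sup>2 \<le> \<bar>A\<bar>\<^sup>2" by (intro power_mono) auto
      then have sq: "(sqrt (A\<^sup>2 - 4))\<^sup>2 = A\<^sup>2 - 4" by simp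
      define \<rho> where "\<rho> = (A + sqrt (A\<^sup>2 - 4)) / 2"
      have "4 * ((A + r) / 2 * (A - (A + r) / 2)) = A\<^sup>2 - r\<^sup>2" for r :: real
        by (simp add: power2_eq_square field_simps)
      then have "4 * (\<rho> * (A - \<rho>)) = A\<^sup>2 - (sqrt (A\<^sup>2 - 4))\<^sup>2"
        unfolding \<rho>_def .
      then have \<rho>: "\<rho> * (A - \<rho>) = 1" unfolding sq by simp
      \<comment> \<open>\<open>(T - (A - \<rho>)) (T - \<rho>) u = 0\<close>, so \<open>(T - \<rho>) u\<close> has the multiplier \<open>A - \<rho>\<close>.\<close>
      have z: "solves_hill a (\<lambda>x. 1 * u1 x + - \<rho> * u x) (\<lambda>x. 1 * v1 x + - \<rho> * v x)"
        by (rule solves_hill_lincomb[OF s1 u])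
      have "1 * u1 (x + p) + - \<rho> * u (x + p) = (A - \<rho>) * (1 * u1 x + - \<rho> * u x)" for x
      proof -
        have "(A - \<rho>) * (1 * u1 x + - \<rho> * u x) = (A - \<rho>) * u1 x - (\<rho> * (A - \<rho>)) * u x"
          by (simp add: algebra_simps)
        also have "\<dots> = A * u1 x - u x - \<rho> * u1 x" unfolding \<rho> by (simp add: algebra_simps)
        also have "\<dots> = 1 * u1 (x + p) + - \<rho> * u (x + p)" unfolding u1_def rec(1) by simp
        finally show ?thesis by simp
      qed
      from nomult[OF z this] have "u (x + p) = \<rho> * u x" for x by (simp add: u1_def)
      from nomult[OF u this] have "u x = 0" for x .
      then have "W = 0" by (simp add: W_def u1_def)
      then show False using \<open>W \<noteq> 0\<close> by simp
    qed
    show ?thesis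
    proof
      show "bounded (range u)"
        by (rule bounded_of_elliptic_recurrence[where p = p and A = A])
          (fact solves_hill_continuous[OF u] p \<open>\<bar>A\<bar> < 2\<close> rec)+
      show "bounded (range v)"
        by (rule bounded_of_elliptic_recurrence[where p = p and A = A])
          (fact solves_hill_continuous_deriv[OF u] p \<open>\<bar>A\<bar> < 2\<close> rec)+
    qed
  qed
qed

text \<open>Without zeros, \<open>w = u' / u\<close> has equal values at \<open>0\<close> and \<open>p\<close> and is nonincreasing by the Riccati
  equation \<open>w' = - a - w\<^sup>2\<close>; hence it is constant and \<open>a = - w\<^sup>2\<close> almost everywhere.\<close>

lemma multiplier_solution_has_zero:
  assumes u: "solves_hill a u v" and p: "p > 0" and mult: "\<And>x. u (x + p) = \<rho> * u x"
    and nonneg: "AE x in lebesgue. 0 < x \<and> x < p \<longrightarrow> 0 \<le> a x"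
    and pos: "\<not> (AE x in lebesgue. 0 < x \<and> x < p \<longrightarrow> a x \<le> 0)"
  shows "\<exists>c. u c = 0"
proof (rule ccontr)
  assume "\<nexists>c. u c = 0"
  then have nz: "u x \<noteq> 0" for x by blast
  define w where "w = (\<lambda>x. v x * inverse (u x))"
  have mult_v: "v (x + p) = \<rho> * v x" for x
  proof (rule DERIV_unique)
    show "((\<lambda>x. u (x + p)) has_real_derivative v (x + p)) (at x)"
      using u by (simp add: solves_hill_DERIV flip: DERIV_shift)
    show "((\<lambda>x. u (x + p)) has_real_derivative \<rho> * v x) (at x)"
      unfolding mult by (rule DERIV_cmult[OF solves_hill_DERIV[OF u]])
  qed
  have "w p = w 0"
    using nz[of "0 + p"] mult[of 0] mult_v[of 0] by (simp add: w_def)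
  have di: "((\<lambda>x. inverse (u x)) has_real_derivative - (v x * inverse ((u x)\<^sup>2))) (at x)" for x
    using DERIV_inverse_fun[OF solves_hill_DERIV[OF u] nz, of x]
    by (simp add: power2_eq_square)
  have "abs_continuous_on 0 p (\<lambda>x. inverse (u x))"
    using nz by (intro abs_continuous_on_C1[OF di] continuous_intros
        solves_hill_continuous[OF u] solves_hill_continuous_deriv[OF u]) auto
  then have acw: "abs_continuous_on 0 p w"
    unfolding w_def by (intro abs_continuous_on_mult solves_hill_AC_deriv[OF u])
  have "AE x in lebesgue. (v has_real_derivative - a x * u x) (at x)"
    using u by (simp add: solves_hill_def)
  then have dw: "AE x in lebesgue. (w has_real_derivative - a x - (w x)\<^sup>2) (at x)"
  proof eventually_elim
    case (elim x)
    show ?case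
      unfolding w_def using DERIV_mult[OF elim di[of x]] nz[of x]
      by (simp add: power2_eq_square mult.commute mult.left_commute)
  qed
  have mono: "AE x in lebesgue. 0 < x \<and> x < p \<longrightarrow> (\<exists>D\<le>0. (w has_real_derivative D) (at x))"
    using dw nonneg
  proof eventually_elim
    case (elim x)
    have "- a x - (w x)\<^sup>2 \<le> 0" if "0 \<le> a x" using that zero_le_power2[of "w x"] by linarith
    with elim show ?case by blast
  qed
  have const: "w x = w 0" if "x \<in> {0..p}" for x
    using abs_continuous_on_antimono_on[OF acw mono, of 0 x]
      abs_continuous_on_antimono_on[OF acw mono, of x p] that \<open>w p = w 0\<close> by auto
  have "AE x in lebesgue. 0 < x \<and> x < p \<longrightarrow> a x \<le> 0"
    using dw
  proof eventually_elim
    case (elim x)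
    show ?case
    proof
      assume x: "0 < x \<and> x < p"
      have "- a x - (w x)\<^sup>2 = 0"
      proof (rule DERIV_local_const[OF elim, of "min x (p - x)"])
        show "\<forall>y. \<bar>x - y\<bar> < min x (p - x) \<longrightarrow> w x = w y"
        proof (intro allI impI)
          fix y assume "\<bar>x - y\<bar> < min x (p - x)"
          then have "x \<in> {0..p}" "y \<in> {0..p}" using x by auto
          then show "w x = w y" using const[of x] const[of y] by linarith
        qed
      qed (use x in auto)
      then show "a x \<le> 0" using zero_le_power2[of "w x"] by linarith
    qed
  qed
  then show False using pos by contradiction
qed

section \<open>The stability criterion\<close>

lemma Linfty_norm_bound:
  assumes L: "L > 0" and N: "ereal (L\<^sup>2) * Linfty_norm s t a \<le> ereal (\<alpha>\<^sup>2)"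
  shows "AE x in lebesgue. s < x \<and> x < t \<longrightarrow> \<bar>a x\<bar> \<le> (\<alpha> / L)\<^sup>2"
proof -
  have "AE x in lebesgue_on {s<..<t}. ereal \<bar>a x\<bar> \<le> Linfty_norm s t a"
    unfolding Linfty_norm_def by (rule esssup_AE)
  then have "AE x in lebesgue. x \<in> {s<..<t} \<longrightarrow> ereal \<bar>a x\<bar> \<le> Linfty_norm s t a"
    by (subst (asm) AE_restrict_space_iff) auto
  then show ?thesis
  proof eventually_elim
    case (elim x)
    show ?case
    proof
      assume "s < x \<and> x < t"
      then have "ereal \<bar>a x\<bar> \<le> Linfty_norm s t a" using elim by simp
      then have "ereal (L\<^sup>2) * ereal \<bar>a x\<bar> \<le> ereal (\<alpha>\<^sup>2)"
        using N by (meson ereal_less_eq(5) ereal_mult_left_mono order_trans zero_le_power2)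
      then have "L\<^sup>2 * \<bar>a x\<bar> \<le> \<alpha>\<^sup>2" by simp
      then show "\<bar>a x\<bar> \<le> (\<alpha> / L)\<^sup>2" using L by (simp add: power_divide field_simps)
    qed
  qed
qed

lemma AE_periodic_translate:
  fixes a :: "real \<Rightarrow> real"
  assumes per: "\<And>x. a (x + p) = a x" and P: "AE x in lebesgue. s < x \<and> x < t \<longrightarrow> P (a x)"
  shows "AE x in lebesgue. of_int n * p + s < x \<and> x < of_int n * p + t \<longrightarrow> P (a x)"
  using AE_lebesgue_translate[OF P, of "of_int (- n) * p"]
proof eventually_elim
  case (elim x)
  then show ?case using periodic_int_mult[of a p x "- n", OF per] by auto
qed

lemma AE_bounded_of_periodic:
  fixes a :: "real \<Rightarrow> real"
  assumes p: "p > 0" and per: "\<And>x. a (x + p) = a x"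
    and a1: "AE x in lebesgue. 0 < x \<and> x < x0 \<longrightarrow> \<bar>a x\<bar> \<le> K1"
    and a2: "AE x in lebesgue. x0 < x \<and> x < p \<longrightarrow> \<bar>a x\<bar> \<le> K2"
  shows "AE x in lebesgue. \<bar>a x\<bar> \<le> max K1 K2"
proof -
  define S where "S = range (\<lambda>n::int. of_int n * p) \<union> range (\<lambda>n::int. of_int n * p + x0)"
  have "countable S" unfolding S_def by auto
  then have S: "AE x in lebesgue. x \<notin> S"
    by (intro AE_not_in null_sets_completionI countable_imp_null_set_lborel)
  have "AE x in lebesgue. \<forall>n::int. of_int n * p + 0 < x \<and> x < of_int n * p + x0 \<longrightarrow> \<bar>a x\<bar> \<le> K1"
    using AE_periodic_translate[OF per a1] by (subst AE_all_countable) blast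
  moreover have "AE x in lebesgue. \<forall>n::int. of_int n * p + x0 < x \<and> x < of_int n * p + p \<longrightarrow> \<bar>a x\<bar> \<le> K2"
    using AE_periodic_translate[OF per a2] by (subst AE_all_countable) blast
  ultimately show ?thesis
    using S
  proof eventually_elim
    case (elim x)
    obtain n :: int where n: "of_int n * p \<le> x" "x < of_int n * p + p"
      using ex_int_multiple_in_period[OF p] .
    have "x \<noteq> of_int n * p" "x \<noteq> of_int n * p + x0" using elim(3) by (auto simp: S_def)
    with n elim(1,2)[rule_format, of n] show ?case by fastforce
  qed
qed

theorem theorem4p2:
  fixes a :: "real \<Rightarrow> real"
  assumes "a \<in> L_pi"
    and "succ_zero a"
    and "\<exists>\<alpha> x\<^sub>0. \<alpha> \<in> {0<..<pi / 2} \<and>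
           x\<^sub>0 \<in> {pi / 2 * (1 - cos \<alpha>)<..<pi / 2 * (1 + cos \<alpha>)} \<and>
           max (ereal (x\<^sub>0\<^sup>2) * Linfty_norm 0 x\<^sub>0 a)
               (ereal ((pi - x\<^sub>0)\<^sup>2) * Linfty_norm x\<^sub>0 pi a) \<le> ereal (\<alpha>\<^sup>2)"
  shows "hill_stable a"
proof -
  obtain \<alpha> x0 where \<alpha>: "0 < \<alpha>" "\<alpha> < pi / 2"
    and x0: "pi / 2 * (1 - cos \<alpha>) < x0" "x0 < pi / 2 * (1 + cos \<alpha>)"
    and N: "ereal (x0\<^sup>2) * Linfty_norm 0 x0 a \<le> ereal (\<alpha>\<^sup>2)"
      "ereal ((pi - x0)\<^sup>2) * Linfty_norm x0 pi a \<le> ereal (\<alpha>\<^sup>2)"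
    using assms(3) by auto
  have gap: "pi - 2 * x0 < cos \<alpha> * pi" "2 * x0 - pi < cos \<alpha> * pi"
    using x0 by (auto simp: field_simps)
  have "cos \<alpha> * pi \<le> 1 * pi" by (intro mult_right_mono) auto
  then have x0pos: "0 < x0" "x0 < pi" using gap by linarith+
  have per: "a (x + pi) = a x" for x using assms(1) by (simp add: L_pi_def)
  define \<omega>1 \<omega>2 where "\<omega>1 = \<alpha> / x0" and "\<omega>2 = \<alpha> / (pi - x0)"
  have \<omega>: "\<omega>1 > 0" "\<omega>2 > 0" "\<omega>1 * x0 = \<alpha>" "\<omega>2 * (pi - x0) = \<alpha>"
    using \<alpha> x0pos by (auto simp: \<omega>1_def \<omega>2_def)
  have a1: "AE x in lebesgue. 0 < x \<and> x < x0 \<longrightarrow> \<bar>a x\<bar> \<le> \<omega>1\<^sup>2"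
    and a2: "AE x in lebesgue. x0 < x \<and> x < pi \<longrightarrow> \<bar>a x\<bar> \<le> \<omega>2\<^sup>2"
    using Linfty_norm_bound[OF x0pos(1) N(1)] Linfty_norm_bound[OF _ N(2)] x0pos
    by (auto simp: \<omega>1_def \<omega>2_def)
  have K: "AE x in lebesgue. \<bar>a x\<bar> \<le> max (\<omega>1\<^sup>2) (\<omega>2\<^sup>2)"
    using AE_bounded_of_periodic[OF pi_gt_zero per a1 a2] .
  have b1: "AE x in lebesgue. of_int n * pi < x \<and> x < of_int n * pi + x0 \<longrightarrow> a x \<le> \<omega>1\<^sup>2"
    and b2: "AE x in lebesgue. of_int n * pi + x0 < x \<and> x < of_int n * pi + pi \<longrightarrow> a x \<le> \<omega>2\<^sup>2" for n :: int
  proof -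
    show "AE x in lebesgue. of_int n * pi < x \<and> x < of_int n * pi + x0 \<longrightarrow> a x \<le> \<omega>1\<^sup>2"
      using AE_periodic_translate[OF per a1, of n] by eventually_elim auto
    show "AE x in lebesgue. of_int n * pi + x0 < x \<and> x < of_int n * pi + pi \<longrightarrow> a x \<le> \<omega>2\<^sup>2"
      using AE_periodic_translate[OF per a2, of n] by eventually_elim auto
  qed
  have nonneg: "AE x in lebesgue. 0 < x \<and> x < pi \<longrightarrow> 0 \<le> a x"
  proof -
    have "AE x in lebesgue_on {0..pi}. 0 \<le> a x" using assms(2) by (simp add: succ_zero_def)
    then have "AE x in lebesgue. x \<in> {0..pi} \<longrightarrow> 0 \<le> a x"
      by (subst (asm) AE_restrict_space_iff) auto
    then show ?thesis by eventually_elim simp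
  qed
  have pos: "\<not> (AE x in lebesgue. 0 < x \<and> x < pi \<longrightarrow> a x \<le> 0)"
  proof
    assume "AE x in lebesgue. 0 < x \<and> x < pi \<longrightarrow> a x \<le> 0"
    then have "negligible ({x. \<not> (0 < x \<and> x < pi \<longrightarrow> a x \<le> 0)} \<union> {0, pi})"
      unfolding AE_lebesgue_iff_negligible by (intro negligible_Un) auto
    moreover have "{x \<in> {0..pi}. a x > 0} \<subseteq> {x. \<not> (0 < x \<and> x < pi \<longrightarrow> a x \<le> 0)} \<union> {0, pi}"
      by auto
    ultimately have "negligible {x \<in> {0..pi}. a x > 0}" by (rule negligible_subset)
    then have "emeasure lebesgue {x \<in> {0..pi}. a x > 0} = 0"
      unfolding negligible_iff_null_sets by (rule null_setsD1)
    then show False using assms(2) unfolding succ_zero_def by (metis less_irrefl)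
  qed
  have nomult: "u x = 0" if u: "solves_hill a u v" and mult: "\<And>x. u (x + pi) = \<rho> * u x" for u v \<rho> x
  proof -
    obtain c where c: "u c = 0"
      using multiplier_solution_has_zero[OF u pi_gt_zero mult nonneg pos] by blast
    then have d: "u (c + pi) = 0" by (simp add: mult)
    obtain n :: int where n: "of_int n * pi \<le> c" "c < of_int n * pi + pi"
      using ex_int_multiple_in_period[OF pi_gt_zero] .
    define m where "m = of_int n * pi"
    have m: "of_int (n + 1) * pi = m + pi" by (simp add: m_def algebra_simps)
    \<comment> \<open>The two cases differ in which of the steps is the middle one of \<open>[c, c + \<pi>]\<close>.\<close>
    note b = b1[of n, folded m_def] b2[of n, folded m_def] b1[of "n + 1", unfolded m] b2[of "n + 1", unfolded m]
    show ?thesis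
    proof (cases "c \<le> m + x0")
      case True
      show ?thesis
      proof (rule hill_disconjugate[OF u K True _ _ \<omega>(1,2) _ _ \<alpha>(2) _ _ _ _ c d, of "m + pi"])
        show "AE x in lebesgue. c < x \<and> x < m + x0 \<longrightarrow> a x \<le> \<omega>1\<^sup>2"
          using b(1) by eventually_elim (use n m_def in auto)
        show "AE x in lebesgue. m + x0 < x \<and> x < m + pi \<longrightarrow> a x \<le> \<omega>2\<^sup>2"
          by (rule b(2))
        show "AE x in lebesgue. m + pi < x \<and> x < c + pi \<longrightarrow> a x \<le> \<omega>1\<^sup>2"
          using b(3) by eventually_elim (use True in auto)
      qed (use n m_def x0pos gap \<omega> in \<open>auto simp: algebra_simps\<close>)
    next
      case False
      show ?thesis
      proof (rule hill_disconjugate[OF u K _ _ _ \<omega>(2,1) _ _ \<alpha>(2) _ _ _ _ c d, of "m + pi" "m + pi + x0"])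
        show "AE x in lebesgue. c < x \<and> x < m + pi \<longrightarrow> a x \<le> \<omega>2\<^sup>2"
          using b(2) by eventually_elim (use False in auto)
        show "AE x in lebesgue. m + pi < x \<and> x < m + pi + x0 \<longrightarrow> a x \<le> \<omega>1\<^sup>2"
          by (rule b(3))
        show "AE x in lebesgue. m + pi + x0 < x \<and> x < c + pi \<longrightarrow> a x \<le> \<omega>2\<^sup>2"
          using b(4) by eventually_elim (use n m_def in auto)
      qed (use n m_def False x0pos gap \<omega> in \<open>auto simp: algebra_simps\<close>)
    qed
  qed
  show ?thesis
    unfolding hill_stable_def
  proof (intro allI impI)
    fix u assume "hill_solution a u"
    then show "bounded (range u) \<and> bounded (range (deriv u))"
      using stable_if_no_real_multiplier[where a = a and p = pi, OF per pi_gt_zero K _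
          hill_solution_imp_solves_hill] nomult by blast
  qed
qed

end
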